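(* For any finite set $X\subset\mathbb{Z}^d$ of non-negative integer vectors, the function $\mathsf{m}_0:\mathrm{Sg}(X)\to\mathbb{Z}_{\ge0}$ (regarded as a function on $\mathbb{Z}_{\ge0}^d$ that vanishes outside $\mathrm{Sg}(X)$) is eventually quasiconstant, i.e. it is eventually quasipolynomial of degree $0$.
   Context: Write $X=\{\boldsymbol{x}_1,\ldots,\boldsymbol{x}_t\}$ with $t=|X|$. The semigroup of $X$ is $\mathrm{Sg}(X)=\{\lambda_1\boldsymbol{x}_1+\cdots+\lambda_t\boldsymbol{x}_t:\lambda_i\in\mathbb{Z}_{\ge0}\}$. For $\boldsymbol{\lambda}\in\mathbb{Z}^t$, $\|\boldsymbol{\lambda}\|_0$ is the number of nonzero entries of $\boldsymbol{\lambda}$. For $\boldsymbol{b}\in\mathrm{Sg}(X)$, $\mathsf{m}_0(\boldsymbol{b})=\min\{\|\boldsymbol{\lambda}\|_0:\boldsymbol{\lambda}\in\mathbb{Z}_{\ge0}^t,\ \lambda_1\boldsymbol{x}_1+\cdots+\lambda_t\boldsymbol{x}_t=\boldsymbol{b}\}$. Given linearly independent $\boldsymbol{u}_1,\ldots,\boldsymbol{u}_s\in\mathbb{Z}_{\ge0}^d$ and $\boldsymbol{b}\in\mathbb{Z}_{\ge0}^d$, the cone generated by $\boldsymbol{u}_1,\ldots,\boldsymbol{u}_s$ translated by $\boldsymbol{b}$ is the set $C=C(\boldsymbol{b};\boldsymbol{u}_1,\ldots,\boldsymbol{u}_s)=\boldsymbol{b}+\mathrm{Sg}(\{\boldsymbol{u}_1,\ldots,\boldsymbol{u}_s\})\subset\mathbb{Z}_{\ge0}^d$.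 A function $f:\mathbb{Z}_{\ge0}^d\to\mathbb{R}$ is a simple quasipolynomial supported on the cone $C$ if $f$ vanishes outside of $C$ and $f$ coincides with a polynomial when restricted to $C$; its degree is the degree of the restriction of $f$ to $C$. A function $f:\mathbb{Z}_{\ge0}^d\to\mathbb{R}$ is eventually quasipolynomial if it is a finite sum of simple quasipolynomials (supported on possibly different cones); its degree is the minimal integer $k$ such that $f$ can be written as a sum of simple quasipolynomials of degree at most $k$. Eventually quasiconstant thus means being a finite sum of simple quasipolynomials each of which is constant on its supporting cone. *)

theory Defs
  imports "HOL-Analysis.Analysis" "HOL-Library.Poly_Mapping"
begin

section \<open>Semigroups and minimal support size\<close>

text \<open>
  The type \<open>nat ^ 'n\<close> is the set of non-negative integer vectors of dimension \<open>CARD('n)\<close>.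
  Coefficient vectors are indexed by the elements of \<open>X\<close> themselves; only the values of
  \<open>l\<close> on \<open>X\<close> matter.
\<close>

definition lin_comb :: "(nat ^ 'n) set \<Rightarrow> (nat ^ 'n \<Rightarrow> nat) \<Rightarrow> nat ^ 'n" where
  "lin_comb X l = (\<Sum>x\<in>X. l x *s x)"

definition Sg :: "(nat ^ 'n) set \<Rightarrow> (nat ^ 'n) set" where
  "Sg X = {lin_comb X l | l. True}"

definition norm0 :: "(nat ^ 'n) set \<Rightarrow> (nat ^ 'n \<Rightarrow> nat) \<Rightarrow> nat" where
  "norm0 X l = card {x \<in> X. l x \<noteq> 0}"

definition m0 :: "(nat ^ 'n) set \<Rightarrow> nat ^ 'n \<Rightarrow> nat" where
  "m0 X b = (LEAST k. \<exists>l. lin_comb X l = b \<and> norm0 X l = k)"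

definition m0_ext :: "(nat ^ 'n) set \<Rightarrow> nat ^ 'n \<Rightarrow> real" where
  "m0_ext X b = (if b \<in> Sg X then real (m0 X b) else 0)"


section \<open>Polynomials in several variables\<close>

text \<open>Monomials are exponent vectors; a polynomial maps each monomial to its coefficient.\<close>

type_synonym 'n mpoly = "('n \<Rightarrow>\<^sub>0 nat) \<Rightarrow>\<^sub>0 real"

definition mpoly_eval :: "'n mpoly \<Rightarrow> real ^ 'n \<Rightarrow> real" where
  "mpoly_eval p x = (\<Sum>m\<in>Poly_Mapping.keys p.
     Poly_Mapping.lookup p m * (\<Prod>i\<in>UNIV. (x $ i) ^ Poly_Mapping.lookup m i))"

text \<open>The zero polynomial has degree 0, as for \<^const>\<open>degree\<close> on univariate polynomials.\<close>

definition mpoly_degree :: "('n::finite) mpoly \<Rightarrow> nat" where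
  "mpoly_degree p = Max (insert 0 ((\<lambda>m. \<Sum>i\<in>UNIV. Poly_Mapping.lookup m i) ` Poly_Mapping.keys p))"


section \<open>Cones and eventually quasipolynomial functions\<close>

definition real_vec :: "nat ^ 'n \<Rightarrow> real ^ 'n" where
  "real_vec x = (\<chi> i. real (x $ i))"

text \<open>
  Since \<^const>\<open>real_vec\<close> is injective, linear independence of a family of pairwise distinct
  vectors is independence of its set of images. The case \<open>U = {}\<close> gives the one-point cone.
\<close>

definition lin_indep :: "(nat ^ 'n) set \<Rightarrow> bool" where
  "lin_indep U \<longleftrightarrow> finite U \<and> independent (real_vec ` U)"

definition cone_at :: "nat ^ 'n \<Rightarrow> (nat ^ 'n) set \<Rightarrow> (nat ^ 'n) set" where
  "cone_at b U = (\<lambda>y. b + y) ` Sg U"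

definition is_cone :: "(nat ^ 'n) set \<Rightarrow> bool" where
  "is_cone C \<longleftrightarrow> (\<exists>b U. lin_indep U \<and> C = cone_at b U)"

definition agrees_on :: "(nat ^ 'n) set \<Rightarrow> (nat ^ 'n \<Rightarrow> real) \<Rightarrow> 'n mpoly \<Rightarrow> bool" where
  "agrees_on C f p \<longleftrightarrow> (\<forall>x\<in>C. f x = mpoly_eval p (real_vec x))"

definition simple_quasipoly_on :: "(nat ^ 'n) set \<Rightarrow> (nat ^ 'n \<Rightarrow> real) \<Rightarrow> bool" where
  "simple_quasipoly_on C f \<longleftrightarrow>
     is_cone C \<and> (\<forall>x. x \<notin> C \<longrightarrow> f x = 0) \<and> (\<exists>p. agrees_on C f p)"

text \<open>
  Several polynomials may agree on a cone that is not full-dimensional; the degree of the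
  restriction is the least degree among them, which is also its degree as a polynomial in the
  coefficients with respect to the generators of the cone.
\<close>

definition simple_degree :: "(nat ^ 'n) set \<Rightarrow> (nat ^ 'n \<Rightarrow> real) \<Rightarrow> nat" where
  "simple_degree C f = (LEAST k. \<exists>p. agrees_on C f p \<and> mpoly_degree p = k)"

definition eventually_quasipoly :: "(nat ^ 'n \<Rightarrow> real) \<Rightarrow> bool" where
  "eventually_quasipoly f \<longleftrightarrow>
     (\<exists>(N::nat) C g. (\<forall>j<N. simple_quasipoly_on (C j) (g j)) \<and> (\<forall>x. f x = (\<Sum>j<N. g j x)))"

definition eventually_quasipoly_degree :: "(nat ^ 'n \<Rightarrow> real) \<Rightarrow> nat" where
  "eventually_quasipoly_degree f = (LEAST k.
     \<exists>(N::nat) C g. (\<forall>j<N. simple_quasipoly_on (C j) (g j) \<and> simple_degree (C j) (g j) \<le> k)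
       \<and> (\<forall>x. f x = (\<Sum>j<N. g j x)))"

definition eventually_quasiconstant :: "(nat ^ 'n \<Rightarrow> real) \<Rightarrow> bool" where
  "eventually_quasiconstant f \<longleftrightarrow>
     (\<exists>(N::nat) C g. (\<forall>j<N. simple_quasipoly_on (C j) (g j) \<and> (\<exists>c. \<forall>x\<in>C j. g j x = c))
       \<and> (\<forall>x. f x = (\<Sum>j<N. g j x)))"

end

theory Submission
  imports Defs
begin

text \<open>Every semigroup \<open>Sg Y\<close> is a finite disjoint union of cones: pick in each fibre of the coefficient
  map the representative of least weight for a multiplicative weight; the set of these normal forms is
  closed downwards and hence, by Dickson's lemma, a finite disjoint union of translated orthants, on
  which the coefficient map is injective. The set where \<open>m0 X \<le> k\<close> is the union of the \<open>Sg Y\<close> over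
  the \<open>Y \<subseteq> X\<close> with at most \<open>k\<close> elements. Since an intersection of two finitely generated
  semigroups is again finitely generated, inclusion-exclusion expresses its indicator through
  indicators of finitely generated semigroups, and \<open>m0\<close> is a linear combination of these.\<close>

section \<open>Minimal elements and weights of coefficient vectors\<close>

text \<open>Induction on \<open>I\<close>. If \<open>m\<close> bounds coordinate \<open>i\<close> on
  the finite set \<open>B0\<close> obtained for \<open>I\<close>, then \<open>B0\<close> handles
  every \<open>a\<close> with \<open>m \<le> a i\<close>. All other elements lie in the finitely
  many slices \<open>a i = v\<close> with \<open>v < m\<close>; there coordinate \<open>i\<close> is
  constant and the induction hypothesis applies to the slice.\<close>

lemma dickson:
  assumes "finite I"
  shows "\<exists>B. finite B \<and> B \<subseteq> A \<and> (\<forall>a\<in>A. \<exists>b\<in>B. \<forall>i\<in>I. b i \<le> (a i :: nat))"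
  using assms
proof (induction I arbitrary: A rule: finite_induct)
  case empty
  show ?case
  proof (cases "A = {}")
    case False
    then obtain a where "a \<in> A" by blast
    then show ?thesis by (intro exI[of _ "{a}"]) auto
  qed (intro exI[of _ "{}"], auto)
next
  case (insert i I)
  obtain B0 where B0: "finite B0" "B0 \<subseteq> A" "\<forall>a\<in>A. \<exists>b\<in>B0. \<forall>i\<in>I. b i \<le> a i"
    using insert.IH[of A] by auto
  define m where "m = Max (insert 0 ((\<lambda>b. b i) ` B0))"
  have m: "b i \<le> m" if "b \<in> B0" for b
    unfolding m_def using B0(1) that by (intro Max_ge) auto
  have "\<forall>v. \<exists>B. finite B \<and> B \<subseteq> {a \<in> A. a i = v} \<and>
      (\<forall>a\<in>{a \<in> A. a i = v}. \<exists>b\<in>B. \<forall>i\<in>I. b i \<le> a i)"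
    by (intro allI insert.IH)
  from choice[OF this] obtain B where *: "\<forall>v. finite (B v) \<and> B v \<subseteq> {a \<in> A. a i = v} \<and>
      (\<forall>a\<in>{a \<in> A. a i = v}. \<exists>b\<in>B v. \<forall>i\<in>I. b i \<le> a i)" ..
  then have B: "finite (B v)" "B v \<subseteq> {a \<in> A. a i = v}"
    "\<forall>a\<in>{a \<in> A. a i = v}. \<exists>b\<in>B v. \<forall>i\<in>I. b i \<le> a i" for v
    using spec[OF *, of v] by blast+
  show ?case
  proof (intro exI conjI ballI)
    show "finite (B0 \<union> (\<Union>v<m. B v))" using B0 B by auto
    show "B0 \<union> (\<Union>v<m. B v) \<subseteq> A" using B0 B by blast
    fix a assume a: "a \<in> A"
    show "\<exists>b\<in>B0 \<union> (\<Union>v<m. B v). \<forall>i\<in>insert i I. b i \<le> a i"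
    proof (cases "a i < m")
      case True
      obtain b where b: "b \<in> B (a i)" "\<forall>i\<in>I. b i \<le> a i" using B(3)[of "a i"] a by auto
      then have "b i = a i" using B(2) by auto
      with b True show ?thesis by (intro bexI[of _ b]) auto
    next
      case False
      obtain b where b: "b \<in> B0" "\<forall>i\<in>I. b i \<le> a i" using B0(3) a by auto
      with m[of b] False show ?thesis by (intro bexI[of _ b]) auto
    qed
  qed
qed

text \<open>Distinct primes are assigned to the elements of \<open>X\<close>, and \<open>N l\<close>
  is the product of their powers with exponents \<open>l x\<close>; unique factorisation recovers
  the exponents. Comparing weights then orders coefficient vectors compatibly with addition and
  without ties on \<open>X\<close>.\<close>

lemma exists_multiplicative_weight:
  assumes "finite X"
  shows "\<exists>N :: ('a \<Rightarrow> nat) \<Rightarrow> nat. (\<forall>l m. N (\<lambda>x. l x + m x) = N l * N m) \<and> (\<forall>l. N l > 0) \<and>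
           (\<forall>l m. N l = N m \<longrightarrow> (\<forall>x\<in>X. l x = m x))"
proof -
  obtain P :: "nat set" where P: "finite P" "card P = card X" "P \<subseteq> {p. prime p}"
    using infinite_arbitrarily_large[OF primes_infinite] by blast
  then obtain h where h: "bij_betw h X P"
    using finite_same_card_bij[OF assms] by metis
  define N where "N = (\<lambda>l::'a \<Rightarrow> nat. \<Prod>x\<in>X. h x ^ l x)"
  have prime: "prime (h x)" if "x \<in> X" for x
    using h P that by (auto simp: bij_betw_def)
  have mult: "multiplicity (h x) (N l) = l x" if "x \<in> X" for l x
  proof -
    have "N l = (\<Prod>p\<in>P. p ^ l (inv_into X h p))"
      unfolding N_def using h by (subst prod.reindex_bij_betw[OF h, symmetric])
        (auto simp: bij_betw_def intro!: prod.cong)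
    then show ?thesis
      using multiplicity_prod_prime_powers[of P "h x" "\<lambda>p. l (inv_into X h p)"]
        P that h prime[OF that] by (auto simp: bij_betw_def subset_iff)
  qed
  show ?thesis
  proof (intro exI[of _ N] conjI allI impI ballI)
    show "N (\<lambda>x. l x + m x) = N l * N m" for l m
      unfolding N_def by (simp add: power_add prod.distrib)
    show "N l > 0" for l
      unfolding N_def by (intro prod_pos) (use prime in \<open>auto dest: prime_gt_0_nat\<close>)
    show "l x = m x" if "N l = N m" "x \<in> X" for l m x
      using mult[OF that(2)] that(1) by metis
  qed
qed

section \<open>Finitely generated semigroups\<close>

lemma lin_comb_nth: "lin_comb X l $ i = (\<Sum>x\<in>X. l x * x $ i)"
  by (simp add: lin_comb_def)

lemma lin_comb_add: "lin_comb X (\<lambda>x. l x + m x) = lin_comb X l + lin_comb X m"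
  by (simp add: vec_eq_iff lin_comb_nth sum.distrib distrib_right)

lemma lin_comb_cong: "(\<And>x. x \<in> X \<Longrightarrow> l x = m x) \<Longrightarrow> lin_comb X l = lin_comb X m"
  by (simp add: lin_comb_def cong: sum.cong)

lemma lin_comb_mono_neutral:
  assumes "finite X" "J \<subseteq> X" "\<And>x. x \<in> X - J \<Longrightarrow> l x = 0"
  shows "lin_comb X l = lin_comb J l"
  unfolding vec_eq_iff lin_comb_nth
  by (intro allI sum.mono_neutral_right) (use assms in auto)

lemma lin_comb_in_Sg: "lin_comb X l \<in> Sg X"
  by (auto simp: Sg_def)

lemma zero_in_Sg: "0 \<in> Sg X"
  using lin_comb_in_Sg[of X "\<lambda>_. 0"] by (simp add: lin_comb_def vec_eq_iff)

lemma Sg_add: "a \<in> Sg X \<Longrightarrow> b \<in> Sg X \<Longrightarrow> a + b \<in> Sg X"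
  unfolding Sg_def using lin_comb_add by (smt (verit) mem_Collect_eq)

lemma generator_in_Sg:
  assumes "finite X" "x \<in> X"
  shows "x \<in> Sg X"
proof -
  have "lin_comb X (\<lambda>y. if y = x then 1 else 0) = x"
    by (rule vec_eq_iff[THEN iffD2])
      (use assms in \<open>simp add: lin_comb_nth if_distrib[of "\<lambda>c. c * _"] cong: if_cong\<close>)
  then show ?thesis by (metis lin_comb_in_Sg)
qed

lemma Sg_scale: "a \<in> Sg X \<Longrightarrow> k *s a \<in> Sg X"
proof (induction k)
  case 0
  then show ?case using zero_in_Sg[of X] by (simp add: vec_eq_iff zero_vec_def vector_scalar_mult_def)
next
  case (Suc k)
  have "Suc k *s a = a + k *s a" by (simp add: vec_eq_iff)
  with Suc Sg_add show ?case by metis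
qed

lemma Sg_sum: "(\<And>x. x \<in> Y \<Longrightarrow> f x \<in> Sg X) \<Longrightarrow> sum f Y \<in> Sg X"
  by (induction Y rule: infinite_finite_induct) (auto simp: zero_in_Sg Sg_add)

lemma Sg_least: "Z \<subseteq> Sg X \<Longrightarrow> Sg Z \<subseteq> Sg X"
  by (auto simp: Sg_def[of Z] lin_comb_def intro!: Sg_sum Sg_scale)

text \<open>The pairs of coefficient vectors representing the same element form a monoid closed under
  differences, so its minimal nonzero elements generate it.\<close>
lemma Sg_Int_finitely_generated:
  assumes X: "finite X" and Y: "finite Y"
  shows "\<exists>Z. finite Z \<and> Sg X \<inter> Sg Y = Sg Z"
proof -
  \<comment> \<open>The disjoint sum lets one function encode a pair of coefficient vectors even
    where \<open>X\<close> and \<open>Y\<close> overlap.\<close>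
  define I where "I = X <+> Y"
  have I: "finite I" using assms by (simp add: I_def)
  let ?L = "\<lambda>f. lin_comb X (\<lambda>x. f (Inl x))" and ?R = "\<lambda>f. lin_comb Y (\<lambda>x. f (Inr x))"
  define A where "A = {f. ?L f = ?R f \<and> (\<exists>i\<in>I. f i \<noteq> 0)}"
  obtain B where B: "finite B" "B \<subseteq> A" "\<forall>a\<in>A. \<exists>b\<in>B. \<forall>i\<in>I. b i \<le> a i"
    using dickson[OF I, of A] by auto
  define Z where "Z = ?L ` B"
  have Z: "finite Z" using B by (simp add: Z_def)
  \<comment> \<open>Descent on the total size of \<open>f\<close>: a nonzero pair dominates some
    \<open>b \<in> B\<close>, and the difference is again a pair with equal values, strictly smaller
    because \<open>b\<close> is nonzero on \<open>I\<close>.\<close>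
  have "?L f \<in> Sg Z" if "?L f = ?R f" for f
    using that
  proof (induction "sum f I" arbitrary: f rule: less_induct)
    case less
    show ?case
    proof (cases "\<exists>i\<in>I. f i \<noteq> 0")
      case False
      then have "f (Inl x) = 0" if "x \<in> X" for x using that by (auto simp: I_def)
      then have "?L f = 0" by (simp add: vec_eq_iff lin_comb_nth)
      then show ?thesis by (simp add: zero_in_Sg)
    next
      case True
      then have "f \<in> A" using less.prems by (auto simp: A_def)
      then obtain b where b: "b \<in> B" "\<forall>i\<in>I. b i \<le> f i" using B(3) by blast
      define g where "g i = f i - b i" for i
      have b_le: "x \<in> X \<Longrightarrow> b (Inl x) \<le> f (Inl x)" "y \<in> Y \<Longrightarrow> b (Inr y) \<le> f (Inr y)" for x y
        using b(2) by (auto simp: I_def)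
      have fL: "?L f = ?L b + ?L g"
        unfolding lin_comb_add[symmetric]
        by (rule lin_comb_cong) (simp add: g_def b_le)
      have fR: "?R f = ?R b + ?R g"
        unfolding lin_comb_add[symmetric]
        by (rule lin_comb_cong) (simp add: g_def b_le)
      have bA: "?L b = ?R b" "\<exists>i\<in>I. b i \<noteq> 0" using b(1) B(2) by (auto simp: A_def)
      have "?L g = ?R g" using fL fR bA less.prems by simp
      moreover have "sum g I < sum f I"
      proof (rule sum_strict_mono_ex1[OF I])
        show "\<exists>i\<in>I. g i < f i"
        proof -
          obtain i where i: "i \<in> I" "b i \<noteq> 0" using bA by blast
          then have "b i \<le> f i" using b by blast
          with i show ?thesis by (intro bexI[of _ i]) (auto simp: g_def)
        qed
      qed (auto simp: g_def)
      ultimately have "?L g \<in> Sg Z" using less.hyps by blast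
      moreover have "?L b \<in> Sg Z" using b Z generator_in_Sg by (auto simp: Z_def)
      ultimately show ?thesis by (simp add: fL Sg_add)
    qed
  qed
  then have L_in: "lin_comb X l \<in> Sg Z" if "lin_comb X l = lin_comb Y m" for l m
    using that by (metis (no_types, lifting) old.sum.simps(5,6) ext)
  have "Sg X \<inter> Sg Y \<subseteq> Sg Z"
  proof
    fix z assume "z \<in> Sg X \<inter> Sg Y"
    then obtain l m where "z = lin_comb X l" "z = lin_comb Y m"
      unfolding Sg_def by blast
    then show "z \<in> Sg Z" using L_in[of l m] by simp
  qed
  moreover have "Sg Z \<subseteq> Sg X"
    by (rule Sg_least) (auto simp: Z_def lin_comb_in_Sg)
  moreover have "Sg Z \<subseteq> Sg Y"
    by (rule Sg_least) (use B(2) in \<open>auto simp: Z_def A_def lin_comb_in_Sg\<close>)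
  ultimately have "Sg X \<inter> Sg Y = Sg Z" by blast
  then show ?thesis using Z by blast
qed

section \<open>Linear independence from unique representations\<close>

text \<open>A real relation is turned into an integral one by simultaneous Diophantine approximation:
  if the errors are small enough, the rounded relation has integer entries of absolute value
  below 1.\<close>
lemma lin_indepI:
  fixes J :: "(nat ^ 'n) set"
  assumes J: "finite J"
    and inj: "\<And>l m x. lin_comb J l = lin_comb J m \<Longrightarrow> x \<in> J \<Longrightarrow> l x = m x"
  shows "lin_indep J"
proof (rule ccontr)
  have inj_rv: "inj_on real_vec J"
    by (auto simp: inj_on_def real_vec_def vec_eq_iff)
  assume "\<not> lin_indep J"
  then have "dependent (real_vec ` J)" using J by (simp add: lin_indep_def)
  then obtain u where u: "\<exists>v\<in>real_vec ` J. u v \<noteq> 0" "(\<Sum>v\<in>real_vec ` J. u v *\<^sub>R v) = 0"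
    using J by (auto simp: dependent_finite)
  then obtain x0 where x0: "x0 \<in> J" "u (real_vec x0) \<noteq> 0" by blast
  \<comment> \<open>Scaling to \<open>d x0 = 1\<close> ensures that the rounded relation does not
    vanish at \<open>x0\<close>.\<close>
  define d where "d x = u (real_vec x) / u (real_vec x0)" for x
  have d: "(\<Sum>x\<in>J. d x * real (x $ i)) = 0" for i
  proof -
    have "(\<Sum>x\<in>J. u (real_vec x) *\<^sub>R real_vec x) = 0"
      using u(2) by (simp add: sum.reindex[OF inj_rv])
    then have "(\<Sum>x\<in>J. u (real_vec x) * real (x $ i)) = 0"
      by (simp add: vec_eq_iff real_vec_def)
    then show ?thesis by (simp add: d_def sum_divide_distrib[symmetric])
  qed
  \<comment> \<open>\<open>K\<close> exceeds the sum over \<open>J\<close> of each coordinate, so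
    errors below \<open>1 / K\<close> in the coefficients add up to less than 1.\<close>
  define K where "K = Suc (\<Sum>x\<in>J. \<Sum>i\<in>UNIV. x $ i)"
  obtain h where h: "bij_betw h {0..<card J} J" using ex_bij_betw_nat_finite[OF J] by blast
  have "K > 0" by (simp add: K_def)
  then obtain q p where qp: "0 < q"
    "\<And>j. j < card J \<Longrightarrow> \<bar>of_int q * d (h j) - of_int (p j)\<bar> < 1 / real K"
    using Dirichlet_approx_simult[of K "card J" "\<lambda>j. d (h j)"] by metis
  define P where "P x = p (inv_into {0..<card J} h x)" for x
  have P: "\<bar>of_int q * d x - of_int (P x)\<bar> < 1 / real K" if "x \<in> J" for x
  proof -
    have "inv_into {0..<card J} h x \<in> {0..<card J}"
      using that h by (metis bij_betw_def inv_into_into)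
    moreover have "h (inv_into {0..<card J} h x) = x"
      using that h by (metis bij_betw_def f_inv_into_f)
    ultimately show ?thesis using qp(2)[of "inv_into {0..<card J} h x"] by (simp add: P_def)
  qed
  have rel: "(\<Sum>x\<in>J. P x * int (x $ i)) = 0" for i
  proof -
    have "real_of_int (\<Sum>x\<in>J. P x * int (x $ i)) =
        (\<Sum>x\<in>J. P x * real (x $ i)) - q * (\<Sum>x\<in>J. d x * real (x $ i))"
      by (simp add: d)
    also have "\<dots> = (\<Sum>x\<in>J. (P x - q * d x) * real (x $ i))"
      by (simp add: sum_distrib_left sum_subtractf algebra_simps)
    finally have eq: "real_of_int (\<Sum>x\<in>J. P x * int (x $ i)) = (\<Sum>x\<in>J. (P x - q * d x) * real (x $ i))" .
    have "\<bar>real_of_int (\<Sum>x\<in>J. P x * int (x $ i))\<bar> \<le> (\<Sum>x\<in>J. \<bar>(P x - q * d x) * real (x $ i)\<bar>)"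
      unfolding eq by (rule sum_abs)
    also have "\<dots> \<le> (\<Sum>x\<in>J. 1 / real K * real (x $ i))"
    proof (rule sum_mono)
      fix x assume "x \<in> J"
      from P[OF this] have "\<bar>P x - q * d x\<bar> \<le> 1 / real K" by linarith
      then show "\<bar>(P x - q * d x) * real (x $ i)\<bar> \<le> 1 / real K * real (x $ i)"
        unfolding abs_mult by (intro mult_mono) auto
    qed
    also have "\<dots> = real (\<Sum>x\<in>J. x $ i) / real K"
      by (simp add: sum_divide_distrib)
    also have "\<dots> < 1"
    proof -
      have "(\<Sum>x\<in>J. x $ i) \<le> (\<Sum>x\<in>J. \<Sum>i\<in>UNIV. x $ i)"
        by (intro sum_mono member_le_sum) auto
      then have "(\<Sum>x\<in>J. x $ i) < K" by (simp add: K_def)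
      then show ?thesis by (simp add: divide_less_eq del: of_nat_sum)
    qed
    finally show ?thesis by linarith
  qed
  \<comment> \<open>The positive and negative parts of \<open>P\<close> are two natural coefficient
    vectors with the same value, so \<open>inj\<close> applies to them.\<close>
  have "(\<Sum>x\<in>J. nat (P x) * x $ i) = (\<Sum>x\<in>J. nat (- P x) * x $ i)" for i
  proof -
    have "P x = int (nat (P x)) - int (nat (- P x))" for x by simp
    then have "(\<Sum>x\<in>J. P x * int (x $ i)) = (\<Sum>x\<in>J. (int (nat (P x)) - int (nat (- P x))) * int (x $ i))"
      by (intro sum.cong arg_cong2[of _ _ _ _ "(*)"] refl)
    then have "0 = (\<Sum>x\<in>J. (int (nat (P x)) - int (nat (- P x))) * int (x $ i))"
      using rel[of i] by simp
    then have "int (\<Sum>x\<in>J. nat (P x) * x $ i) = int (\<Sum>x\<in>J. nat (- P x) * x $ i)"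
      by (simp only: left_diff_distrib sum_subtractf of_nat_sum of_nat_mult)
    then show ?thesis by linarith
  qed
  then have "nat (P x0) = nat (- P x0)"
    using inj[of "\<lambda>x. nat (P x)" "\<lambda>x. nat (- P x)" x0] x0
    by (simp add: vec_eq_iff lin_comb_nth)
  then have "P x0 = 0" by linarith
  \<comment> \<open>With \<open>P x0 = 0\<close> the approximation error at \<open>x0\<close> is
    \<open>q\<close> itself, a positive integer.\<close>
  moreover have "d x0 = 1" using x0 by (simp add: d_def)
  ultimately have "real_of_int q < 1 / real K" using P[OF x0(1)] by simp
  also have "\<dots> \<le> 1" using \<open>K > 0\<close> by simp
  finally show False using qp(1) by simp
qed

section \<open>Quasiconstant functions\<close>

lemma simple_quasipoly_on_const:
  fixes C :: "(nat ^ 'n) set"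
  assumes "is_cone C" "\<And>x. x \<notin> C \<Longrightarrow> g x = 0" "\<And>x. x \<in> C \<Longrightarrow> g x = c"
  shows "simple_quasipoly_on C g \<and> simple_degree C g = 0"
proof -
  define p :: "'n mpoly" where "p = Poly_Mapping.single 0 c"
  \<comment> \<open>The case split is needed because \<open>Poly_Mapping.single 0 0\<close> has no
    keys, whereas otherwise the only key is the exponent vector 0.\<close>
  have "mpoly_eval p y = c" for y
    by (cases "c = 0") (simp_all add: mpoly_eval_def p_def)
  then have "agrees_on C g p" using assms by (simp add: agrees_on_def)
  moreover have "mpoly_degree p = 0"
    by (cases "c = 0") (simp_all add: mpoly_degree_def p_def)
  ultimately have "\<exists>p. agrees_on C g p \<and> mpoly_degree p = 0" by blast
  then show ?thesis
    using assms unfolding simple_quasipoly_on_def simple_degree_def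
    by (auto intro: Least_eq_0)
qed

text \<open>The degree is a least natural number, so one decomposition into summands of degree 0
  determines it.\<close>

lemma quasiconstant_imp_quasipoly:
  assumes "eventually_quasiconstant f"
  shows "eventually_quasipoly f" "eventually_quasipoly_degree f = 0"
proof -
  obtain N :: nat and C g where
    *: "\<forall>j<N. simple_quasipoly_on (C j) (g j) \<and> (\<exists>c. \<forall>x\<in>C j. g j x = c)"
      "\<forall>x. f x = (\<Sum>j<N. g j x)"
    using assms unfolding eventually_quasiconstant_def by blast
  then show "eventually_quasipoly f" unfolding eventually_quasipoly_def by blast
  have "simple_degree (C j) (g j) \<le> 0" if "j < N" for j
    using * that simple_quasipoly_on_const[of "C j" "g j"] unfolding simple_quasipoly_on_def by blast
  with * show "eventually_quasipoly_degree f = 0"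
    unfolding eventually_quasipoly_degree_def by (intro Least_eq_0) blast
qed

lemma quasiconstant_cone:
  assumes "lin_indep U"
  shows "eventually_quasiconstant (indicator (cone_at b U))"
proof -
  have C: "is_cone (cone_at b U)" using assms by (auto simp: is_cone_def)
  then have "simple_quasipoly_on (cone_at b U) (indicator (cone_at b U))"
    using simple_quasipoly_on_const[of "cone_at b U" "indicator (cone_at b U)" 1] by simp
  then show ?thesis unfolding eventually_quasiconstant_def
    by (intro exI[of _ "Suc 0"] exI[of _ "\<lambda>_. cone_at b U"] exI[of _ "\<lambda>_. indicator (cone_at b U)"])
      (auto intro!: exI[of _ 1])
qed

lemma quasiconstant_uminus:
  assumes "eventually_quasiconstant f"
  shows "eventually_quasiconstant (\<lambda>x. - f x)"
proof -
  obtain N :: nat and C g where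
    *: "\<forall>j<N. simple_quasipoly_on (C j) (g j) \<and> (\<exists>c. \<forall>x\<in>C j. g j x = c)"
      "\<forall>x. f x = (\<Sum>j<N. g j x)"
    using assms unfolding eventually_quasiconstant_def by blast
  have "simple_quasipoly_on (C j) (\<lambda>x. - g j x) \<and> (\<exists>c. \<forall>x\<in>C j. - g j x = c)" if j: "j < N" for j
  proof -
    obtain c where c: "\<forall>x\<in>C j. g j x = c" using * j by blast
    then have "simple_quasipoly_on (C j) (\<lambda>x. - g j x)"
      using simple_quasipoly_on_const[of "C j" "\<lambda>x. - g j x" "- c"] *(1) j
      unfolding simple_quasipoly_on_def by simp
    with c show ?thesis by simp
  qed
  then show ?thesis unfolding eventually_quasiconstant_def
    by (intro exI[of _ N] exI[of _ C] exI[of _ "\<lambda>j x. - g j x"]) (simp add: * sum_negf)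
qed

lemma quasiconstant_add:
  assumes "eventually_quasiconstant f" "eventually_quasiconstant f'"
  shows "eventually_quasiconstant (\<lambda>x. f x + f' x)"
proof -
  obtain N :: nat and C g where
    *: "\<forall>j<N. simple_quasipoly_on (C j) (g j) \<and> (\<exists>c. \<forall>x\<in>C j. g j x = c)"
      "\<forall>x. f x = (\<Sum>j<N. g j x)"
    using assms(1) unfolding eventually_quasiconstant_def by blast
  obtain N' :: nat and C' g' where
    **: "\<forall>j<N'. simple_quasipoly_on (C' j) (g' j) \<and> (\<exists>c. \<forall>x\<in>C' j. g' j x = c)"
      "\<forall>x. f' x = (\<Sum>j<N'. g' j x)"
    using assms(2) unfolding eventually_quasiconstant_def by blast
  define D where "D j = (if j < N then C j else C' (j - N))" for j
  define h where "h j = (if j < N then g j else g' (j - N))" for j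
  have "(\<Sum>j<N + M. h j x) = (\<Sum>j<N. g j x) + (\<Sum>j<M. g' j x)" for M x
    by (induction M) (auto simp: h_def)
  moreover have "simple_quasipoly_on (D j) (h j) \<and> (\<exists>c. \<forall>x\<in>D j. h j x = c)" if "j < N + N'" for j
    using that * ** by (auto simp: D_def h_def)
  ultimately show ?thesis unfolding eventually_quasiconstant_def
    by (intro exI[of _ "N + N'"] exI[of _ D] exI[of _ h]) (auto simp: * **)
qed

lemma quasiconstant_zero: "eventually_quasiconstant (\<lambda>_. 0)"
  unfolding eventually_quasiconstant_def by (intro exI[of _ 0]) auto

lemma quasiconstant_diff:
  "eventually_quasiconstant f \<Longrightarrow> eventually_quasiconstant g \<Longrightarrow> eventually_quasiconstant (\<lambda>x. f x - g x)"
  using quasiconstant_add[OF _ quasiconstant_uminus] by fastforce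

lemma quasiconstant_sum:
  "(\<And>a. a \<in> A \<Longrightarrow> eventually_quasiconstant (F a)) \<Longrightarrow> eventually_quasiconstant (\<lambda>x. \<Sum>a\<in>A. F a x)"
  by (induction A rule: infinite_finite_induct) (auto simp: quasiconstant_zero intro: quasiconstant_add)

section \<open>Indicators of unions of semigroups\<close>

text \<open>By Dickson's lemma, membership of \<open>l\<close> in the set \<open>M\<close> of normal forms depends only on \<open>l\<close>
  truncated at some height \<open>m\<close>. Sorting \<open>M\<close> by truncations yields the orthants.\<close>
lemma quasiconstant_Sg:
  fixes X :: "(nat ^ 'n) set"
  assumes X: "finite X"
  shows "eventually_quasiconstant (indicator (Sg X))"
proof -
  obtain N :: "(nat ^ 'n \<Rightarrow> nat) \<Rightarrow> nat" where
    N_add: "\<And>l m. N (\<lambda>x. l x + m x) = N l * N m" and N_pos: "\<And>l. N l > 0" and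
    N_inj: "\<And>l m x. N l = N m \<Longrightarrow> x \<in> X \<Longrightarrow> l x = m x"
    using exists_multiplicative_weight[OF X] by blast
  \<comment> \<open>Fixing the irrelevant values outside \<open>X\<close> makes normal forms unique
    as functions.\<close>
  define F where "F = {l :: nat ^ 'n \<Rightarrow> nat. \<forall>x. x \<notin> X \<longrightarrow> l x = 0}"
  define M where "M = {l \<in> F. \<forall>k\<in>F. lin_comb X k = lin_comb X l \<longrightarrow> N l \<le> N k}"
  have M_unique: "l = k" if "l \<in> M" "k \<in> M" "lin_comb X l = lin_comb X k" for l k
  proof
    fix x
    have "N l \<le> N k" "N k \<le> N l" using that by (simp_all add: M_def)
    then have "N l = N k" by (rule le_antisym)
    then show "l x = k x" using N_inj that by (cases "x \<in> X") (auto simp: M_def F_def)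
  qed
  have M_exists: "\<exists>l\<in>M. lin_comb X l = b" if b: "b \<in> Sg X" for b
  proof -
    obtain l0 where l0: "b = lin_comb X l0" using b by (auto simp: Sg_def)
    have "lin_comb X (\<lambda>x. if x \<in> X then l0 x else 0) = b"
      unfolding l0 by (rule lin_comb_cong) simp
    then have "\<exists>l. l \<in> F \<and> lin_comb X l = b"
      by (intro exI[of _ "\<lambda>x. if x \<in> X then l0 x else 0"]) (simp add: F_def)
    then obtain l where "l \<in> F \<and> lin_comb X l = b"
      "\<forall>k. k \<in> F \<and> lin_comb X k = b \<longrightarrow> N l \<le> N k"
      by (elim exE, drule_tac ex_has_least_nat[where m = N]) blast
    then show ?thesis by (intro bexI[of _ l]) (auto simp: M_def)
  qed
  \<comment> \<open>If some \<open>k'\<close> represents the same element as \<open>k\<close> with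
    less weight, then adding \<open>d = l - k\<close> to \<open>k'\<close> gives a representative
    lighter than \<open>l\<close>, by multiplicativity.\<close>
  have M_down: "k \<in> M" if l: "l \<in> M" and kl: "\<And>x. k x \<le> l x" for k l
  proof (rule ccontr)
    assume "k \<notin> M"
    moreover have kF: "k \<in> F" using l kl by (auto simp: M_def F_def) (metis le_zero_eq)
    ultimately obtain k' where k': "k' \<in> F" "lin_comb X k' = lin_comb X k" "N k' < N k"
      by (auto simp: M_def not_le)
    define d where "d x = l x - k x" for x
    have l_eq: "l = (\<lambda>x. k x + d x)" using kl by (auto simp: d_def)
    have "lin_comb X (\<lambda>x. k' x + d x) = lin_comb X l"
      by (simp add: l_eq lin_comb_add k')
    moreover have "(\<lambda>x. k' x + d x) \<in> F" using k' l by (auto simp: M_def F_def d_def)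
    ultimately have "N l \<le> N (\<lambda>x. k' x + d x)" using l by (auto simp: M_def)
    then show False using k'(3) N_pos[of d] by (simp add: l_eq N_add)
  qed
  obtain B where B: "finite B" "B \<subseteq> F - M" "\<forall>a\<in>F - M. \<exists>b\<in>B. \<forall>x\<in>X. b x \<le> a x"
    using dickson[OF X, of "F - M"] by blast
  \<comment> \<open>Every obstruction \<open>b \<in> B\<close> has entries at most \<open>m\<close>
    on \<open>X\<close>, so truncating a vector at \<open>m\<close> keeps it above the same
    obstructions. The inserted 0 covers the case of an empty set.\<close>
  define m where "m = Max (insert 0 ((\<lambda>(b, x). b x) ` (B \<times> X)))"
  have m: "b x \<le> m" if "b \<in> B" "x \<in> X" for b x
    unfolding m_def using B(1) X that by (intro Max_ge) (auto intro!: image_eqI[of _ _ "(b, x)"])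
  have M_trunc: "l \<in> M" if lF: "l \<in> F" and t: "(\<lambda>x. min (l x) m) \<in> M" for l
  proof (rule ccontr)
    assume "l \<notin> M"
    then obtain b where b: "b \<in> B" "\<forall>x\<in>X. b x \<le> l x" using B(3) lF by blast
    have "b x \<le> min (l x) m" for x
      using b m[of b x] B(2) by (cases "x \<in> X") (auto simp: F_def)
    then have "b \<in> M" using M_down[OF t] by blast
    then show False using b B by blast
  qed
  define T where "T = {c \<in> M. \<forall>x. c x \<le> m}"
  \<comment> \<open>The saturated coordinates: exactly these can grow without changing the
    truncation \<open>c\<close>, so they generate the cone attached to \<open>c\<close>.\<close>
  define J where "J c = {x \<in> X. c x = m}" for c :: "nat ^ 'n \<Rightarrow> nat"
  define K where "K c = cone_at (lin_comb X c) (J c)" for c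
  have "T \<subseteq> {c. \<forall>x. (x \<in> X \<longrightarrow> c x \<in> {..m}) \<and> (x \<notin> X \<longrightarrow> c x = 0)}"
    by (auto simp: T_def M_def F_def)
  then have T: "finite T"
    by (rule finite_subset) (use X in \<open>intro finite_set_of_finite_funs; simp\<close>)
  have shift: "\<exists>l'\<in>M. lin_comb X l' = lin_comb X c + lin_comb (J c) l \<and>
      (\<lambda>x. min (l' x) m) = c \<and> (\<forall>x\<in>J c. l' x = c x + l x)" if c: "c \<in> T" for c l
  proof -
    define l' where "l' x = c x + (if x \<in> J c then l x else 0)" for x
    have min: "(\<lambda>x. min (l' x) m) = c"
      using c by (auto simp: l'_def J_def T_def)
    have "l' \<in> F" using c by (auto simp: l'_def J_def T_def M_def F_def)
    then have "l' \<in> M" using M_trunc min c by (simp add: T_def)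
    moreover have "lin_comb X (\<lambda>x. if x \<in> J c then l x else 0) = lin_comb (J c) l"
      using lin_comb_mono_neutral[OF X, of "J c" "\<lambda>x. if x \<in> J c then l x else 0"]
      by (auto simp: J_def intro!: lin_comb_cong)
    then have "lin_comb X l' = lin_comb X c + lin_comb (J c) l"
      by (simp add: l'_def[abs_def] lin_comb_add)
    ultimately show ?thesis using min by (intro bexI[of _ l']) (auto simp: l'_def)
  qed
  have indep: "lin_indep (J c)" if c: "c \<in> T" for c
  proof (rule lin_indepI)
    show "finite (J c)" using X by (simp add: J_def)
    fix l k x assume eq: "lin_comb (J c) l = lin_comb (J c) k" and x: "x \<in> J c"
    obtain l' where l': "l' \<in> M" "lin_comb X l' = lin_comb X c + lin_comb (J c) l"
      "\<forall>x\<in>J c. l' x = c x + l x" using shift[OF c] by blast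
    obtain k' where k': "k' \<in> M" "lin_comb X k' = lin_comb X c + lin_comb (J c) k"
      "\<forall>x\<in>J c. k' x = c x + k x" using shift[OF c] by blast
    have "l' = k'" using M_unique l' k' eq by simp
    then show "l x = k x" using l' k' x by simp
  qed
  have trunc_T: "(\<lambda>x. min (l x) m) \<in> T" if "l \<in> M" for l
    using M_down[OF that, of "\<lambda>x. min (l x) m"] by (simp add: T_def)
  \<comment> \<open>The truncation of the normal form names the only cone containing the element,
    which makes the union of cones disjoint.\<close>
  have K_iff: "lin_comb X l \<in> K c \<longleftrightarrow> (\<lambda>x. min (l x) m) = c" if l: "l \<in> M" and c: "c \<in> T" for l c
  proof
    assume "lin_comb X l \<in> K c"
    then obtain k where k: "lin_comb X l = lin_comb X c + lin_comb (J c) k"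
      by (auto simp: K_def cone_at_def Sg_def)
    obtain l' where l': "l' \<in> M" "lin_comb X l' = lin_comb X c + lin_comb (J c) k"
      "(\<lambda>x. min (l' x) m) = c" using shift[OF c] by blast
    then show "(\<lambda>x. min (l x) m) = c" using M_unique[OF l l'(1)] k by simp
  next
    assume eq: "(\<lambda>x. min (l x) m) = c"
    have "lin_comb X (\<lambda>x. l x - c x) = lin_comb (J c) (\<lambda>x. l x - c x)"
      by (rule lin_comb_mono_neutral[OF X]) (auto simp: J_def eq[symmetric])
    moreover have "lin_comb X l = lin_comb X c + lin_comb X (\<lambda>x. l x - c x)"
      unfolding lin_comb_add[symmetric] by (rule lin_comb_cong) (simp add: eq[symmetric])
    ultimately show "lin_comb X l \<in> K c"
      unfolding K_def cone_at_def using lin_comb_in_Sg by (metis imageI)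
  qed
  have "(indicator (Sg X) b :: real) = (\<Sum>c\<in>T. indicator (K c) b)" for b
  proof (cases "b \<in> Sg X")
    case True
    then obtain l where l: "l \<in> M" "lin_comb X l = b" using M_exists by blast
    have "(\<Sum>c\<in>T. indicator (K c) b :: real) = (\<Sum>c\<in>T. if (\<lambda>x. min (l x) m) = c then 1 else 0)"
      using K_iff[OF l(1)] l(2) by (intro sum.cong) (auto simp: indicator_def)
    then show ?thesis using True trunc_T[OF l(1)] T by simp
  next
    case False
    have "b \<notin> K c" if c: "c \<in> T" for c
    proof
      assume "b \<in> K c"
      then obtain k where "b = lin_comb X c + lin_comb (J c) k"
        by (auto simp: K_def cone_at_def Sg_def)
      then show False using shift[OF c, of k] False lin_comb_in_Sg by metis
    qed
    then show ?thesis using False by simp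
  qed
  moreover have "eventually_quasiconstant (\<lambda>b. \<Sum>c\<in>T. indicator (K c) b)"
    unfolding K_def by (rule quasiconstant_sum[OF quasiconstant_cone[OF indep]])
  ultimately show ?thesis by (metis (no_types, lifting) ext)
qed

text \<open>Inclusion-exclusion adding one semigroup at a time. The overlap of the new semigroup
  with the earlier union is a union of \<open>n\<close> finitely generated semigroups, so the
  induction hypothesis, general in \<open>Y\<close>, covers it too.\<close>

lemma quasiconstant_UN_Sg:
  assumes "\<And>i. i < n \<Longrightarrow> finite (Y i)"
  shows "eventually_quasiconstant (indicator (\<Union>i<(n::nat). Sg (Y i)))"
  using assms
proof (induction n arbitrary: Y)
  case 0
  then show ?case using quasiconstant_zero by (simp add: indicator_def)
next
  case (Suc n)
  let ?U = "\<Union>i<n. Sg (Y i)"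
  have "\<forall>i<n. \<exists>Z. finite Z \<and> Sg (Y i) \<inter> Sg (Y n) = Sg Z"
    using Sg_Int_finitely_generated Suc.prems by (meson less_Suc_eq)
  then obtain Z where Z: "\<And>i. i < n \<Longrightarrow> finite (Z i)" "\<And>i. i < n \<Longrightarrow> Sg (Y i) \<inter> Sg (Y n) = Sg (Z i)"
    by metis
  have int: "?U \<inter> Sg (Y n) = (\<Union>i<n. Sg (Z i))" using Z(2) by blast
  have "eventually_quasiconstant
      (\<lambda>x. (indicator ?U x + indicator (Sg (Y n)) x) - indicator (\<Union>i<n. Sg (Z i)) x)"
    by (rule quasiconstant_diff[OF quasiconstant_add[OF Suc.IH quasiconstant_Sg] Suc.IH])
      (use Suc.prems Z in auto)
  moreover have "indicator (\<Union>i<Suc n. Sg (Y i)) =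
      (\<lambda>x. (indicator ?U x + indicator (Sg (Y n)) x) - indicator (\<Union>i<n. Sg (Z i)) x :: real)"
    unfolding int[symmetric] lessThan_Suc by (auto simp: indicator_def)
  ultimately show ?case by simp
qed

text \<open>The support of a coefficient vector serves as \<open>Y\<close>; conversely, coefficients
  on \<open>Y\<close> are extended by zero.\<close>

lemma ex_norm0_le_iff:
  assumes X: "finite X"
  shows "(\<exists>l. lin_comb X l = b \<and> norm0 X l \<le> k) \<longleftrightarrow> b \<in> (\<Union>Y\<in>{Y. Y \<subseteq> X \<and> card Y \<le> k}. Sg Y)"
proof
  assume "\<exists>l. lin_comb X l = b \<and> norm0 X l \<le> k"
  then obtain l where l: "lin_comb X l = b" "norm0 X l \<le> k" by blast
  have "lin_comb X l = lin_comb {x \<in> X. l x \<noteq> 0} l"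
    by (rule lin_comb_mono_neutral[OF X]) auto
  then have "b \<in> Sg {x \<in> X. l x \<noteq> 0}" using l lin_comb_in_Sg by metis
  with l show "b \<in> (\<Union>Y\<in>{Y. Y \<subseteq> X \<and> card Y \<le> k}. Sg Y)"
    by (intro UN_I[of "{x \<in> X. l x \<noteq> 0}"]) (auto simp: norm0_def)
next
  assume "b \<in> (\<Union>Y\<in>{Y. Y \<subseteq> X \<and> card Y \<le> k}. Sg Y)"
  then obtain Y l where Y: "Y \<subseteq> X" "card Y \<le> k" "b = lin_comb Y l" by (auto simp: Sg_def)
  define l' where "l' x = (if x \<in> Y then l x else 0)" for x
  have "lin_comb X l' = lin_comb Y l'"
    by (rule lin_comb_mono_neutral[OF X Y(1)]) (auto simp: l'_def)
  also have "\<dots> = b" unfolding Y(3) by (rule lin_comb_cong) (simp add: l'_def)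
  finally have "lin_comb X l' = b" .
  moreover have "norm0 X l' \<le> card Y"
    unfolding norm0_def by (rule card_mono) (use Y X in \<open>auto simp: l'_def intro: finite_subset\<close>)
  ultimately show "\<exists>l. lin_comb X l = b \<and> norm0 X l \<le> k" using Y(2) by (intro exI[of _ l']) auto
qed

text \<open>A number \<open>m \<le> t\<close> equals the number of \<open>k < t\<close> with \<open>\<not> m \<le> k\<close>; the sets where
  \<open>m0 X \<le> k\<close> are unions of semigroups.\<close>
lemma m0_ext_eq_sum:
  fixes X :: "(nat ^ 'n) set"
  assumes X: "finite X"
  shows "m0_ext X b = (\<Sum>k<card X. indicator (Sg X) b -
    indicator (\<Union>Y\<in>{Y. Y \<subseteq> X \<and> card Y \<le> k}. Sg Y) b)"
proof (cases "b \<in> Sg X")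
  case False
  have "Sg Y \<subseteq> Sg X" if "Y \<subseteq> X" for Y
    by (rule Sg_least) (use that generator_in_Sg[OF X] in blast)
  with False have "b \<notin> (\<Union>Y\<in>{Y. Y \<subseteq> X \<and> card Y \<le> k}. Sg Y)" for k by blast
  with False show ?thesis by (simp add: m0_ext_def)
next
  case True
  then obtain l0 where l0: "lin_comb X l0 = b" by (auto simp: Sg_def)
  then have ex: "\<exists>l. lin_comb X l = b \<and> norm0 X l = m0 X b"
    unfolding m0_def
    by (intro LeastI_ex[of "\<lambda>k. \<exists>l. lin_comb X l = b \<and> norm0 X l = k"] exI[of _ "norm0 X l0"] exI[of _ l0]) simp
  have le: "m0 X b \<le> norm0 X l" if "lin_comb X l = b" for l
    unfolding m0_def using that by (intro Least_le) blast
  have iff: "b \<in> (\<Union>Y\<in>{Y. Y \<subseteq> X \<and> card Y \<le> k}. Sg Y) \<longleftrightarrow> m0 X b \<le> k" for k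
    unfolding ex_norm0_le_iff[OF X, symmetric] using ex le by (metis le_trans order_refl)
  have "m0 X b \<le> card X"
    using le[OF l0] card_mono[OF X, of "{x \<in> X. l0 x \<noteq> 0}"] by (auto simp: norm0_def)
  then have "{..<card X} \<inter> {k. k < m0 X b} = {..<m0 X b}" by auto
  then have "real (m0 X b) = (\<Sum>k<card X. if k < m0 X b then 1 else 0)"
    by (simp add: sum.If_cases)
  also have "\<dots> = (\<Sum>k<card X. indicator (Sg X) b -
      indicator (\<Union>Y\<in>{Y. Y \<subseteq> X \<and> card Y \<le> k}. Sg Y) b)"
    by (intro sum.cong refl) (simp only: indicator_def iff True, simp)
  finally show ?thesis using True by (simp add: m0_ext_def)
qed

lemma quasiconstant_m0_ext:
  assumes X: "finite X"
  shows "eventually_quasiconstant (m0_ext X)"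
proof -
  have "eventually_quasiconstant (indicator (\<Union>Y\<in>{Y. Y \<subseteq> X \<and> card Y \<le> k}. Sg Y))" for k
  proof -
    have fin: "finite {Y. Y \<subseteq> X \<and> card Y \<le> k}" using X by simp
    \<comment> \<open>The subsets are enumerated because \<open>quasiconstant_UN_Sg\<close> treats
      unions indexed by an initial segment of the naturals.\<close>
    obtain h where h: "bij_betw h {0..<card {Y. Y \<subseteq> X \<and> card Y \<le> k}} {Y. Y \<subseteq> X \<and> card Y \<le> k}"
      using ex_bij_betw_nat_finite[OF fin] by blast
    have eq: "(\<Union>Y\<in>{Y. Y \<subseteq> X \<and> card Y \<le> k}. Sg Y) = (\<Union>i<card {Y. Y \<subseteq> X \<and> card Y \<le> k}. Sg (h i))"
      using bij_betw_imp_surj_on[OF h] by (simp flip: image_image add: atLeast0LessThan)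
    show ?thesis unfolding eq
    proof (rule quasiconstant_UN_Sg)
      fix i assume "i < card {Y. Y \<subseteq> X \<and> card Y \<le> k}"
      then have "h i \<subseteq> X" using bij_betwE[OF h] by simp
      then show "finite (h i)" using X by (rule finite_subset)
    qed
  qed
  then have "eventually_quasiconstant (\<lambda>b. \<Sum>k<card X. indicator (Sg X) b -
      indicator (\<Union>Y\<in>{Y. Y \<subseteq> X \<and> card Y \<le> k}. Sg Y) b)"
    by (rule quasiconstant_sum[OF quasiconstant_diff[OF quasiconstant_Sg[OF X]]])
  moreover have "m0_ext X = (\<lambda>b. \<Sum>k<card X. indicator (Sg X) b -
      indicator (\<Union>Y\<in>{Y. Y \<subseteq> X \<and> card Y \<le> k}. Sg Y) b)"
    using m0_ext_eq_sum[OF X] by (intro ext)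
  ultimately show ?thesis by simp
qed

theorem theorem11:
  fixes X :: "(nat ^ 'n) set"
  assumes "finite X"
  shows "eventually_quasiconstant (m0_ext X)
    \<and> eventually_quasipoly (m0_ext X)
    \<and> eventually_quasipoly_degree (m0_ext X) = 0"
  using quasiconstant_m0_ext[OF assms] quasiconstant_imp_quasipoly by blast

end
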